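(* Suppose $A=[a_{ij}]\in\mathbb{R}^{n\times n}$, $n\ge 2$, is a Type-I bdsw matrix with $a_{n1}>0$ and $a_{nn}<0$. Then $A\notin\mathbf{Q}$.
   Context: A matrix $A=[a_{ij}]\in\mathbb{R}^{n\times n}$, $n\ge 2$, is a bidiagonal southwest (bdsw) matrix if $a_{ij}=0$ unless $j=i$, or $j=i+1$, or $(i,j)=(n,1)$; the entries in these positions are arbitrary real numbers (possibly zero). A Type-I bdsw matrix is a bdsw matrix that contains at least one (nonzero) nonnegative row; standing assumption: every row of the bdsw matrix has a positive entry (no row is nonpositive). For $A\in\mathbb{R}^{n\times n}$ and $q\in\mathbb{R}^n$, $\mathrm{LCP}(A,q)$ is the problem of finding $x\in\mathbb{R}^n$ with $x\ge 0$, $Ax+q\ge 0$ and $x^\top(Ax+q)=0$ (componentwise inequalities). $A\in\mathbf{Q}$ if $\mathrm{LCP}(A,q)$ has a solution for every $q\in\mathbb{R}^n$. *)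

theory Defs
  imports Complex_Main "Jordan_Normal_Form.Matrix"
begin

(* Rows and columns are numbered from 0: the entry a_{ij} of the usual 1-based notation
   is A $$ (i - 1, j - 1), so the southwest corner a_{n1} is A $$ (n - 1, 0). *)

definition bdsw :: "nat \<Rightarrow> real mat \<Rightarrow> bool" where
  "bdsw n A \<longleftrightarrow> 2 \<le> n \<and> A \<in> carrier_mat n n \<and>
     (\<forall>i<n. \<forall>j<n. \<not> (j = i \<or> j = i + 1 \<or> (i = n - 1 \<and> j = 0)) \<longrightarrow> A $$ (i, j) = 0)"

(* The standing assumption on bdsw matrices: no row is nonpositive. *)
definition rows_have_pos_entry :: "nat \<Rightarrow> real mat \<Rightarrow> bool" where
  "rows_have_pos_entry n A \<longleftrightarrow> (\<forall>i<n. \<exists>j<n. A $$ (i, j) > 0)"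

definition type_I_bdsw :: "nat \<Rightarrow> real mat \<Rightarrow> bool" where
  "type_I_bdsw n A \<longleftrightarrow> bdsw n A \<and> (\<exists>i<n. 0\<^sub>v n \<le> row A i \<and> row A i \<noteq> 0\<^sub>v n)"

(* The order on vectors is componentwise (and requires equal dimensions). *)
definition LCP_solution :: "nat \<Rightarrow> real mat \<Rightarrow> real vec \<Rightarrow> real vec \<Rightarrow> bool" where
  "LCP_solution n A q x \<longleftrightarrow> x \<in> carrier_vec n \<and> 0\<^sub>v n \<le> x \<and> 0\<^sub>v n \<le> A *\<^sub>v x + q \<and>
     x \<bullet> (A *\<^sub>v x + q) = 0"

definition Q_matrices :: "nat \<Rightarrow> real mat set" where
  "Q_matrices n = {A \<in> carrier_mat n n. \<forall>q \<in> carrier_vec n. \<exists>x. LCP_solution n A q x}"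

end

theory Submission
  imports Defs
begin

text \<open>
  Take q to be -1 where the diagonal entry of A is negative and 1 elsewhere, and let x solve
  LCP(A, q). Positivity of w = A x + q in the nonnegative row k forces x to vanish at k.
  Vanishing propagates backwards along the superdiagonal: if x vanishes at i + 1, then w at i is
  a_{ii} x_i + q_i, which would be negative if a_{ii} < 0 and is otherwise positive, so that x
  vanishes at i. Hence x vanishes at the first index, and then the last entry of w is negative.
\<close>

text \<open>A sum of nonnegative terms vanishes only if each term does, so the single orthogonality
  condition yields complementarity at every index.\<close>

lemma LCP_solutionD:
  assumes "LCP_solution n A q x" "A \<in> carrier_mat n n" "q \<in> carrier_vec n" "i < n"
  shows "x $ i \<ge> 0" "(A *\<^sub>v x) $ i + q $ i \<ge> 0" "x $ i * ((A *\<^sub>v x) $ i + q $ i) = 0"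
proof -
  let ?w = "A *\<^sub>v x + q"
  have x: "x \<in> carrier_vec n" "0\<^sub>v n \<le> x" and w: "0\<^sub>v n \<le> ?w" "x \<bullet> ?w = 0"
    using assms(1) by (auto simp: LCP_solution_def)
  have x_nonneg: "x $ j \<ge> 0" if "j < n" for j
    using x that by (auto simp: less_eq_vec_def)
  have w_nonneg: "?w $ j \<ge> 0" if "j < n" for j
    using w(1) that assms(3) unfolding less_eq_vec_def by (metis index_zero_vec)
  have "(\<Sum>j\<in>{0..<n}. x $ j * ?w $ j) = 0"
    using w(2) assms(3) by (simp add: scalar_prod_def)
  then have "x $ i * ?w $ i = 0"
    using x_nonneg w_nonneg assms(4)
    by (subst (asm) sum_nonneg_eq_0_iff) (auto intro!: mult_nonneg_nonneg simp del: index_add_vec)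
  then show "x $ i \<ge> 0" "(A *\<^sub>v x) $ i + q $ i \<ge> 0" "x $ i * ((A *\<^sub>v x) $ i + q $ i) = 0"
    using x_nonneg[OF assms(4)] w_nonneg[OF assms(4)] assms(3,4) by auto
qed

lemma mult_mat_vec_eq_two_terms:
  fixes A :: "real mat"
  assumes "A \<in> carrier_mat m n" "x \<in> carrier_vec n" "i < m" "j < n" "k < n" "j \<noteq> k"
    and "\<And>l. l < n \<Longrightarrow> l \<noteq> j \<Longrightarrow> l \<noteq> k \<Longrightarrow> A $$ (i, l) = 0"
  shows "(A *\<^sub>v x) $ i = A $$ (i, j) * x $ j + A $$ (i, k) * x $ k"
proof -
  have "(A *\<^sub>v x) $ i = (\<Sum>l\<in>{0..<n}. A $$ (i, l) * x $ l)"
    using assms(1-3) by (auto simp: scalar_prod_def intro!: sum.cong)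
  also have "\<dots> = (\<Sum>l\<in>{j, k}. A $$ (i, l) * x $ l)"
    using assms(4,5,7) by (intro sum.mono_neutral_right) auto
  finally show ?thesis
    using assms(6) by simp
qed

text \<open>The last row has no superdiagonal position, and its corner takes over that role. Since n
  is at least 2, the two columns involved are distinct there as well.\<close>

lemma bdsw_mult_vec:
  assumes "bdsw n A" "x \<in> carrier_vec n"
  shows bdsw_mult_vec_upper:
      "Suc i < n \<Longrightarrow> (A *\<^sub>v x) $ i = A $$ (i, i) * x $ i + A $$ (i, Suc i) * x $ Suc i"
    and bdsw_mult_vec_last:
      "(A *\<^sub>v x) $ (n - 1) = A $$ (n - 1, n - 1) * x $ (n - 1) + A $$ (n - 1, 0) * x $ 0"
proof -
  have A: "2 \<le> n" "A \<in> carrier_mat n n"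
    and zero: "\<And>i j. i < n \<Longrightarrow> j < n \<Longrightarrow> j \<noteq> i \<Longrightarrow> j \<noteq> Suc i \<Longrightarrow> \<not> (i = n - 1 \<and> j = 0) \<Longrightarrow>
      A $$ (i, j) = 0"
    using assms(1) unfolding bdsw_def by (blast, blast, simp)
  show "(A *\<^sub>v x) $ i = A $$ (i, i) * x $ i + A $$ (i, Suc i) * x $ Suc i" if "Suc i < n"
    by (rule mult_mat_vec_eq_two_terms[OF A(2) assms(2)]) (use that in \<open>auto intro!: zero\<close>)
  show "(A *\<^sub>v x) $ (n - 1) = A $$ (n - 1, n - 1) * x $ (n - 1) + A $$ (n - 1, 0) * x $ 0"
    by (rule mult_mat_vec_eq_two_terms[OF A(2) assms(2)]) (use A(1) in \<open>auto intro!: zero\<close>)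
qed

theorem theorem5p4:
  fixes n :: nat and A :: "real mat"
  assumes "n \<ge> 2"
    and "A \<in> carrier_mat n n"
    and "type_I_bdsw n A"
    and "rows_have_pos_entry n A"
    and "A $$ (n - 1, 0) > 0"
    and "A $$ (n - 1, n - 1) < 0"
  shows "A \<notin> Q_matrices n"
proof
  assume "A \<in> Q_matrices n"
  \<comment> \<open>This sign pattern keeps \<open>A $$ (i, i) * t + q $ i\<close> away from 0 for
    every t \<ge> 0: it is at most -1 if the diagonal entry is negative and at least 1
    otherwise.\<close>
  define q where "q = vec n (\<lambda>i. if A $$ (i, i) < 0 then - 1 else 1 :: real)"
  have q: "q \<in> carrier_vec n"
    by (simp add: q_def)
  with \<open>A \<in> Q_matrices n\<close> obtain x where sol: "LCP_solution n A q x"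
    by (auto simp: Q_matrices_def)
  then have x: "x \<in> carrier_vec n"
    by (simp add: LCP_solution_def)
  note solD = LCP_solutionD[OF sol assms(2) q]
  from assms(3) obtain k where bdsw: "bdsw n A" and k: "k < n" "0\<^sub>v n \<le> row A k"
    by (auto simp: type_I_bdsw_def)
  have row_k: "A $$ (k, j) \<ge> 0" if "j < n" for j
    using k that assms(2) by (auto simp: less_eq_vec_def)
  \<comment> \<open>The last row has a negative diagonal entry, so it cannot be the nonnegative
    row.\<close>
  have "k \<noteq> n - 1"
    using row_k[of k] k(1) assms(6) by auto
  with k have "Suc k < n"
    by simp
  have "x $ k = 0"
  proof -
    have "(A *\<^sub>v x) $ k \<ge> 0"
      using bdsw_mult_vec_upper[OF bdsw x \<open>Suc k < n\<close>] row_k solD(1) k \<open>Suc k < n\<close> by simp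
    moreover have "q $ k = 1"
      using row_k[of k] k by (simp add: q_def)
    ultimately show ?thesis
      using solD(3)[OF k(1)] by simp
  qed
  have "x $ 0 = 0"
    \<comment> \<open>The induction descends from k to 0. Its indices i < k never reach the last
      row, so the superdiagonal formula applies throughout.\<close>
    using le0[of k]
  proof (induction rule: inc_induct)
    case base
    show ?case by fact
  next
    case (step i)
    then have i: "i < n" "Suc i < n"
      using \<open>Suc k < n\<close> by simp_all
    have Ax: "(A *\<^sub>v x) $ i = A $$ (i, i) * x $ i"
      using bdsw_mult_vec_upper[OF bdsw x i(2)] step.IH by simp
    have "A $$ (i, i) \<ge> 0"
    proof (rule ccontr)
      assume neg: "\<not> A $$ (i, i) \<ge> 0"
      then have "A $$ (i, i) * x $ i \<le> 0"
        using solD(1)[OF i(1)] by (simp add: mult_nonpos_nonneg)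
      with Ax neg solD(2)[OF i(1)] i(1) show False
        by (simp add: q_def)
    qed
    then have "(A *\<^sub>v x) $ i + q $ i > 0"
      using Ax solD(1)[OF i(1)] i(1) by (simp add: q_def add_nonneg_pos)
    with solD(3)[OF i(1)] show ?case
      by simp
  qed
  \<comment> \<open>The corner term drops out because \<open>x $ 0 = 0\<close>, whatever the size of
    the corner entry.\<close>
  then have "(A *\<^sub>v x) $ (n - 1) \<le> 0"
    using bdsw_mult_vec_last[OF bdsw x] assms(1,6) solD(1)[of "n - 1"]
    by (simp add: mult_nonpos_nonneg)
  moreover have "q $ (n - 1) = - 1"
    using assms(1,6) by (simp add: q_def)
  ultimately show False
    using solD(2)[of "n - 1"] assms(1) by simp
qed

end
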